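(* Let $\rho\in[0,1]$, let $G_i,G_j,H_{ij},\Psi\ge 0$, let $N_u,N_d>0$ and let $P_u^{max},P_d^{max}>0$. Consider the problem of maximizing, over $P_d\in[0,P_d^{max}]$ with the uplink power set to $P_u=P_u^{max}$, the SIC-mode network utility $$R_N^{SIC}(P_u^{max},P_d)=\rho\log_2\Big(1+\frac{P_dG_j}{N_d}\Big)+(1-\rho)\log_2\Big(1+\min\Big\{\frac{P_u^{max}G_i}{P_d\Psi+N_u},\ \frac{P_u^{max}H_{ij}}{P_dG_j+N_d}\Big\}\Big).$$ Then any optimal downlink power $P_d$ is one of the following candidates: 1. $P_d=0$; 2. $P_d=P_d^{max}$; 3. $P_d=\dfrac{H_{ij}N_u-G_iN_d}{G_iG_j-\Psi H_{ij}}$ (a candidate only when $G_iG_j\neq \Psi H_{ij}$); 4. a solution $P_d$ of $$\rho G_j(P_dG_j+P_u^{max}H_{ij}+N_d)(P_dG_j+N_d)-(1-\rho)P_u^{max}G_jH_{ij}(P_dG_j+N_d)=0;$$ 5. a solution $P_d$ of $$\rho G_j(P_d\Psi+P_u^{max}G_i+N_u)(P_d\Psi+N_u)-(1-\rho)P_u^{max}G_i\Psi(P_dG_j+N_d)=0.$$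
   Context: A full-duplex base station serves user $i$ in uplink and a different user $j$ in downlink, at the same time and on the same channel. $G_i,G_j$ are the channel power gains between the base station and users $i,j$. $H_{ij}$ is the channel power gain between the two users. $\Psi$ is the effective self-interference gain at the base station. $N_u,N_d$ are the uplink and downlink noise powers. $P_u,P_d$ are the uplink and downlink transmit powers, subject to $0\le P_u\le P_u^{max}$ and $0\le P_d\le P_d^{max}$. In SIC mode (full duplex with successive interference cancellation) the downlink user decodes and cancels the uplink signal, and the signal to interference and noise ratios are $$SINR_{UL}^{SIC}=\min\Big\{\frac{P_uG_i}{P_d\Psi+N_u},\ \frac{P_uH_{ij}}{P_dG_j+N_d}\Big\},\qquad SINR_{DL}^{SIC}=\frac{P_dG_j}{N_d}.$$ Rates follow the Shannon model $R=\log_2(1+SINR)$. The network utility is $R_N^{SIC}=\rho R_{DL}^{SIC}+(1-\rho)R_{UL}^{SIC}$. The power optimization problem maximizes $R_N^{SIC}(P_u,P_d)$ subject to the power constraints. Since $R_N^{SIC}$ is nondecreasing in $P_u$, the choice $P_u=P_u^{max}$ is optimal, and the problem reduces to choosing $P_d$. *)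

theory Defs
  imports Complex_Main
begin

definition SINR_UL_SIC :: "real \<Rightarrow> real \<Rightarrow> real \<Rightarrow> real \<Rightarrow> real \<Rightarrow> real \<Rightarrow> real \<Rightarrow> real \<Rightarrow> real" where
  "SINR_UL_SIC G\<^sub>i G\<^sub>j H\<^sub>i\<^sub>j \<Psi> N\<^sub>u N\<^sub>d P\<^sub>u P\<^sub>d =
     min (P\<^sub>u * G\<^sub>i / (P\<^sub>d * \<Psi> + N\<^sub>u)) (P\<^sub>u * H\<^sub>i\<^sub>j / (P\<^sub>d * G\<^sub>j + N\<^sub>d))"

definition SINR_DL_SIC :: "real \<Rightarrow> real \<Rightarrow> real \<Rightarrow> real" where
  "SINR_DL_SIC G\<^sub>j N\<^sub>d P\<^sub>d = P\<^sub>d * G\<^sub>j / N\<^sub>d"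

definition shannon_rate :: "real \<Rightarrow> real" where
  "shannon_rate sinr = log 2 (1 + sinr)"

definition utility_SIC ::
  "real \<Rightarrow> real \<Rightarrow> real \<Rightarrow> real \<Rightarrow> real \<Rightarrow> real \<Rightarrow> real \<Rightarrow> real \<Rightarrow> real \<Rightarrow> real" where
  "utility_SIC \<rho> G\<^sub>i G\<^sub>j H\<^sub>i\<^sub>j \<Psi> N\<^sub>u N\<^sub>d P\<^sub>u P\<^sub>d =
     \<rho> * shannon_rate (SINR_DL_SIC G\<^sub>j N\<^sub>d P\<^sub>d) +
     (1 - \<rho>) * shannon_rate (SINR_UL_SIC G\<^sub>i G\<^sub>j H\<^sub>i\<^sub>j \<Psi> N\<^sub>u N\<^sub>d P\<^sub>u P\<^sub>d)"

end

theory Submission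
  imports Defs
begin

text \<open>At an interior maximizer where the two uplink ratios differ, or where they coincide for every
  \<open>P\<^sub>d\<close>, the utility agrees near that point with the utility of a single smooth ratio, so the
  derivative vanishes; clearing denominators gives one of the two polynomial equations.
  Otherwise the point is the unique crossing of the two ratios, which is the third candidate.\<close>

text \<open>With \<open>A\<close>, \<open>B\<close>, \<open>M\<close> free, one computation covers
  both uplink ratios. The derivative at \<open>x\<close> is a positive multiple of a difference of
  two fractions with positive denominators. Fermat's criterion makes this difference zero, and
  cross-multiplying gives the stated equation.\<close>

lemma local_max_single_ratio_stationary:
  fixes \<rho> G N A B M x :: real
  assumes "G \<ge> 0" "N > 0" "A \<ge> 0" "B \<ge> 0" "M > 0" "x > 0"
    and max: "\<forall>\<^sub>F p in nhds x.
      \<rho> * shannon_rate (p * G / N) + (1 - \<rho>) * shannon_rate (A / (p * B + M))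
      \<le> \<rho> * shannon_rate (x * G / N) + (1 - \<rho>) * shannon_rate (A / (x * B + M))"
  shows "\<rho> * G * (x * B + A + M) * (x * B + M) - (1 - \<rho>) * A * B * (x * G + N) = 0"
proof -
  define f where
    "f p = \<rho> * shannon_rate (p * G / N) + (1 - \<rho>) * shannon_rate (A / (p * B + M))" for p
  \<comment> \<open>\<open>D\<close> is \<open>ln 2\<close> times the derivative of \<open>f\<close>
    at \<open>x\<close>, with the inner fractions already simplified.\<close>
  define D where "D = \<rho> * (G / (x * G + N)) -
    (1 - \<rho>) * (A * B / ((x * B + M) * (x * B + A + M)))"
  have pos: "x * G + N > 0" "x * B + M > 0" "x * B + A + M > 0"
    using assms(1-6) by (simp_all add: add_nonneg_pos)
  have args: "1 + x * G / N > 0" "1 + A / (x * B + M) > 0"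
    using assms(1-6) pos by (simp_all add: add_pos_nonneg)
  have log_deriv: "((\<lambda>p. log 2 (g p)) has_real_derivative g' / g x / ln 2) (at x)"
    if "(g has_real_derivative g') (at x)" "g x > 0" for g g'
    unfolding log_def
    using DERIV_cdivide[OF DERIV_chain2[OF DERIV_ln_divide[OF that(2)] that(1)]] by simp
  have dl_arg: "((\<lambda>p. 1 + p * G / N) has_real_derivative G / N) (at x)"
    using assms(2) by (auto intro!: derivative_eq_intros)
  have dl_eq: "G / N / (1 + x * G / N) = G / (x * G + N)"
    using assms(2) pos(1) args(1) by (simp add: divide_simps add.commute)
  have dl: "((\<lambda>p. log 2 (1 + p * G / N)) has_real_derivative G / (x * G + N) / ln 2) (at x)"
    using log_deriv[OF dl_arg args(1)] unfolding dl_eq .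
  have "((\<lambda>p. p * B + M) has_real_derivative B) (at x)"
    by (auto intro!: derivative_eq_intros)
  from DERIV_add[OF DERIV_const DERIV_divide[OF DERIV_const this]] have ul_arg: "((\<lambda>p. 1 + A / (p * B + M)) has_real_derivative - (A * B) / ((x * B + M) * (x * B + M))) (at x)"
    using pos(2) by simp
  \<comment> \<open>Over the common denominator \<open>x * B + M\<close>, the argument of the
    logarithm cancels one of the two equal factors from the quotient rule. This leaves the factor
    \<open>x * B + A + M\<close> of the final equation.\<close>
  have ul_eq: "- (A * B) / ((x * B + M) * (x * B + M)) / (1 + A / (x * B + M))
      = - (A * B / ((x * B + M) * (x * B + A + M)))"
  proof -
    have "1 + A / (x * B + M) = (x * B + A + M) / (x * B + M)"
      using pos(2) by (simp add: add_divide_eq_iff add_ac)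
    then show ?thesis using pos(2) by simp
  qed
  have ul: "((\<lambda>p. log 2 (1 + A / (p * B + M))) has_real_derivative
      - (A * B / ((x * B + M) * (x * B + A + M))) / ln 2) (at x)"
    using log_deriv[OF ul_arg args(2)] unfolding ul_eq .
  have "(f has_real_derivative D / ln 2) (at x)"
    unfolding f_def shannon_rate_def
    using DERIV_add[OF DERIV_cmult[OF dl, of \<rho>] DERIV_cmult[OF ul, of "1 - \<rho>"]]
    by (simp add: D_def diff_divide_distrib)
  moreover obtain d where "d > 0" "\<forall>p. \<bar>x - p\<bar> < d \<longrightarrow> f p \<le> f x"
    using max unfolding f_def eventually_nhds_metric by (auto simp: dist_real_def abs_minus_commute)
  ultimately have "D / ln 2 = 0"
    by (rule DERIV_local_max)
  then have "D = 0" by simp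
  then have "\<rho> * G / (x * G + N) = (1 - \<rho>) * (A * B) / ((x * B + M) * (x * B + A + M))"
    by (simp add: D_def)
  then show ?thesis
    using pos by (simp add: frac_eq_eq mult_ac)
qed

text \<open>The difference of the two ratios is continuous at \<open>x\<close> because both
  denominators are positive there, so its strict sign persists nearby. This fixes which ratio
  attains the minimum around the maximizer.\<close>

lemma eventually_ratio_less:
  fixes a b c d e h x :: real
  assumes "x * b + c > 0" "x * e + h > 0" "a / (x * b + c) < d / (x * e + h)"
  shows "\<forall>\<^sub>F p in nhds x. a / (p * b + c) < d / (p * e + h)"
proof -
  have "((\<lambda>p. d / (p * e + h) - a / (p * b + c)) \<longlongrightarrow> d / (x * e + h) - a / (x * b + c)) (nhds x)"
    using assms by (intro tendsto_intros filterlim_ident) auto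
  then have "\<forall>\<^sub>F p in nhds x. 0 < d / (p * e + h) - a / (p * b + c)"
    by (rule order_tendstoD) (use assms in simp)
  then show ?thesis by simp
qed

theorem lemma2:
  fixes \<rho> G\<^sub>i G\<^sub>j H\<^sub>i\<^sub>j \<Psi> N\<^sub>u N\<^sub>d P\<^sub>u_max P\<^sub>d_max P\<^sub>d :: real
  assumes "\<rho> \<in> {0..1}"
    and "G\<^sub>i \<ge> 0" and "G\<^sub>j \<ge> 0" and "H\<^sub>i\<^sub>j \<ge> 0" and "\<Psi> \<ge> 0"
    and "N\<^sub>u > 0" and "N\<^sub>d > 0"
    and "P\<^sub>u_max > 0" and "P\<^sub>d_max > 0"
    and "is_arg_max (\<lambda>P. utility_SIC \<rho> G\<^sub>i G\<^sub>j H\<^sub>i\<^sub>j \<Psi> N\<^sub>u N\<^sub>d P\<^sub>u_max P) (\<lambda>P. P \<in> {0..P\<^sub>d_max}) P\<^sub>d"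
  shows "P\<^sub>d = 0
    \<or> P\<^sub>d = P\<^sub>d_max
    \<or> (G\<^sub>i * G\<^sub>j \<noteq> \<Psi> * H\<^sub>i\<^sub>j \<and> P\<^sub>d = (H\<^sub>i\<^sub>j * N\<^sub>u - G\<^sub>i * N\<^sub>d) / (G\<^sub>i * G\<^sub>j - \<Psi> * H\<^sub>i\<^sub>j))
    \<or> \<rho> * G\<^sub>j * (P\<^sub>d * G\<^sub>j + P\<^sub>u_max * H\<^sub>i\<^sub>j + N\<^sub>d) * (P\<^sub>d * G\<^sub>j + N\<^sub>d)
        - (1 - \<rho>) * P\<^sub>u_max * G\<^sub>j * H\<^sub>i\<^sub>j * (P\<^sub>d * G\<^sub>j + N\<^sub>d) = 0
    \<or> \<rho> * G\<^sub>j * (P\<^sub>d * \<Psi> + P\<^sub>u_max * G\<^sub>i + N\<^sub>u) * (P\<^sub>d * \<Psi> + N\<^sub>u)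
        - (1 - \<rho>) * P\<^sub>u_max * G\<^sub>i * \<Psi> * (P\<^sub>d * G\<^sub>j + N\<^sub>d) = 0"
proof -
  define u v where "u = (\<lambda>p. P\<^sub>u_max * G\<^sub>i / (p * \<Psi> + N\<^sub>u))"
    and "v = (\<lambda>p. P\<^sub>u_max * H\<^sub>i\<^sub>j / (p * G\<^sub>j + N\<^sub>d))"
  \<comment> \<open>The uplink ratio becomes a parameter \<open>s\<close>, so that the true utility
    and its single-ratio versions are instances of one scheme.\<close>
  define U where "U s p =
    \<rho> * shannon_rate (p * G\<^sub>j / N\<^sub>d) + (1 - \<rho>) * shannon_rate (s p)" for s and p :: real
  have U: "utility_SIC \<rho> G\<^sub>i G\<^sub>j H\<^sub>i\<^sub>j \<Psi> N\<^sub>u N\<^sub>d P\<^sub>u_max = U (\<lambda>p. min (u p) (v p))"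
    by (simp add: fun_eq_iff utility_SIC_def SINR_UL_SIC_def SINR_DL_SIC_def U_def u_def v_def)
  have range: "P\<^sub>d \<in> {0..P\<^sub>d_max}"
    and opt: "\<And>p. p \<in> {0..P\<^sub>d_max} \<Longrightarrow> U (\<lambda>p. min (u p) (v p)) p \<le> U (\<lambda>p. min (u p) (v p)) P\<^sub>d"
    using assms(10) unfolding U is_arg_max_linorder by auto
  show ?thesis
  proof (cases "P\<^sub>d = 0 \<or> P\<^sub>d = P\<^sub>d_max")
    case False
    then have interior: "P\<^sub>d \<in> {0<..<P\<^sub>d_max}" using range by auto
    then have "P\<^sub>d > 0" by simp
    \<comment> \<open>Interiority turns the constrained maximum into a two-sided local
      maximum.\<close>
    have "\<forall>\<^sub>F p in nhds P\<^sub>d. p \<in> {0<..<P\<^sub>d_max}"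
      using interior by (intro eventually_nhds_in_open) auto
    then have max: "\<forall>\<^sub>F p in nhds P\<^sub>d. U (\<lambda>p. min (u p) (v p)) p \<le> U (\<lambda>p. min (u p) (v p)) P\<^sub>d"
      by eventually_elim (auto intro: opt)
    have local: "\<forall>\<^sub>F p in nhds P\<^sub>d. U s p \<le> U s P\<^sub>d"
      if "\<forall>\<^sub>F p in nhds P\<^sub>d. min (u p) (v p) = s p" for s
    proof -
      \<comment> \<open>Agreement on a neighbourhood includes the point itself, so both sides of the
        maximality inequality can be rewritten.\<close>
      have "U (\<lambda>p. min (u p) (v p)) P\<^sub>d = U s P\<^sub>d"
        using eventually_nhds_x_imp_x[OF that] by (simp add: U_def)
      with max have "\<forall>\<^sub>F p in nhds P\<^sub>d. U (\<lambda>p. min (u p) (v p)) p \<le> U s P\<^sub>d" by simp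
      with that show ?thesis
        by eventually_elim (simp add: U_def)
    qed
    have pos: "P\<^sub>d * \<Psi> + N\<^sub>u > 0" "P\<^sub>d * G\<^sub>j + N\<^sub>d > 0"
      using assms \<open>P\<^sub>d > 0\<close> by (simp_all add: add_nonneg_pos)
    \<comment> \<open>The base station ratio \<open>u\<close> leads to the last candidate
      equation.\<close>
    have stat_u: ?thesis if "\<forall>\<^sub>F p in nhds P\<^sub>d. U u p \<le> U u P\<^sub>d"
      using local_max_single_ratio_stationary[of G\<^sub>j N\<^sub>d "P\<^sub>u_max * G\<^sub>i" \<Psi> N\<^sub>u P\<^sub>d \<rho>]
        assms \<open>P\<^sub>d > 0\<close> that
      by (simp add: U_def u_def mult_ac)
    \<comment> \<open>The ratio \<open>v\<close> has the downlink signal as interference, so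
      \<open>G\<^sub>j\<close> and \<open>N\<^sub>d\<close> appear in both rates; this gives the
      fourth candidate.\<close>
    have stat_v: ?thesis if "\<forall>\<^sub>F p in nhds P\<^sub>d. U v p \<le> U v P\<^sub>d"
      using local_max_single_ratio_stationary[of G\<^sub>j N\<^sub>d "P\<^sub>u_max * H\<^sub>i\<^sub>j" G\<^sub>j N\<^sub>d P\<^sub>d \<rho>]
        assms \<open>P\<^sub>d > 0\<close> that
      by (simp add: U_def v_def mult_ac)
    consider "u P\<^sub>d < v P\<^sub>d" | "v P\<^sub>d < u P\<^sub>d" | "u P\<^sub>d = v P\<^sub>d" by linarith
    then show ?thesis
    proof cases
      case 1
      then have "\<forall>\<^sub>F p in nhds P\<^sub>d. u p < v p"
        unfolding u_def v_def by (intro eventually_ratio_less pos)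
      then have "\<forall>\<^sub>F p in nhds P\<^sub>d. min (u p) (v p) = u p"
        by eventually_elim simp
      then show ?thesis by (intro stat_u local)
    next
      case 2
      then have "\<forall>\<^sub>F p in nhds P\<^sub>d. v p < u p"
        unfolding u_def v_def by (intro eventually_ratio_less pos)
      then have "\<forall>\<^sub>F p in nhds P\<^sub>d. min (u p) (v p) = v p"
        by eventually_elim simp
      then show ?thesis by (intro stat_v local)
    next
      case 3
      then have "G\<^sub>i * (P\<^sub>d * G\<^sub>j + N\<^sub>d) = H\<^sub>i\<^sub>j * (P\<^sub>d * \<Psi> + N\<^sub>u)"
        using pos assms(8) by (simp add: u_def v_def frac_eq_eq)
      \<comment> \<open>Both denominators are affine in the downlink power, so the crossing
        condition is linear in it.\<close>
      then have cross: "P\<^sub>d * (G\<^sub>i * G\<^sub>j - \<Psi> * H\<^sub>i\<^sub>j) = H\<^sub>i\<^sub>j * N\<^sub>u - G\<^sub>i * N\<^sub>d"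
        by (simp add: algebra_simps)
      show ?thesis
      proof (cases "G\<^sub>i * G\<^sub>j = \<Psi> * H\<^sub>i\<^sub>j")
        case False
        then show ?thesis using cross by (simp add: eq_divide_eq)
      next
        case True
        \<comment> \<open>With zero slope the constant term vanishes too, so the crossing equation
          holds identically in \<open>p\<close>. The minimum then has no kink and equals
          \<open>u\<close> near the maximizer.\<close>
        have N: "H\<^sub>i\<^sub>j * N\<^sub>u = G\<^sub>i * N\<^sub>d" using cross True by simp
        have "u p = v p" if "p \<in> {0<..<P\<^sub>d_max}" for p
        proof -
          have "p * \<Psi> + N\<^sub>u > 0" "p * G\<^sub>j + N\<^sub>d > 0"
            using assms that by (simp_all add: add_nonneg_pos)
          moreover have "G\<^sub>i * (p * G\<^sub>j + N\<^sub>d) = H\<^sub>i\<^sub>j * (p * \<Psi> + N\<^sub>u)"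
            using True N by (simp add: algebra_simps)
          ultimately show ?thesis by (simp add: u_def v_def frac_eq_eq)
        qed
        then have "\<forall>\<^sub>F p in nhds P\<^sub>d. min (u p) (v p) = u p"
          using \<open>\<forall>\<^sub>F p in nhds P\<^sub>d. p \<in> {0<..<P\<^sub>d_max}\<close> by (auto elim: eventually_mono)
        then show ?thesis by (intro stat_u local)
      qed
    qed
  qed blast
qed

end
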